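(* Let $d\ge 1$ be an integer, let $(P,H,I)$ be an incidence geometry such that $I$ is a basis of the $d$-plane matroid, let $p\in P$, and let $S\in\mathbb{R}^{d\times H}$. Then the columns of $S$ are the normal vectors of a nontrivial realization of $(P,H,I)$ if and only if $S$ satisfies the pure condition of $(P,H,I)$, i.e. if and only if $\det(M_S^p(P,H,I)) = 0$.
   Context: An incidence geometry is a triple $(P,H,I)$ where $P$ is a finite set (of points), $H$ is a finite set (of hyperplanes) and $I \subseteq P\times H$ is an arbitrary subset (of incidences). $\mathbb{R}^{d\times H}$ denotes the set of real matrices with $d$ rows and with columns indexed by $H$; the column of $S$ indexed by $h$ is $S_h$. For $I''\subseteq I$, let $P(I'')$ and $H(I'')$ denote the projections of $I''\subseteq P\times H$ to $P$ and $H$. In the $d$-plane matroid on $I$, a set $I'\subseteq I$ is independent if $|I''|\le |H(I'')|+d|P(I'')|-d$ for all nonempty $I''\subseteq I'$. "$I$ is a basis of the $d$-plane matroid" means that $I$ is independent in this sense and $|I| = |H|+d|P|-d$. A realization of $(P,H,I)$ with normal vectors given by the columns of $S$ (a parallel redrawing) consists of functions $x:P\to\mathbb{R}^d$ and $y:H\to\mathbb{R}$ such that $\langle S_h, x(p)\rangle + y(h)=0$ for all $(p,h)\in I$. It is trivial if $x$ assigns the same point of $\mathbb{R}^d$ to all elements of $P$, and nontrivial otherwise. $M_S(P,H,I)$ is the $|I|\times(|H|+d|P|)$ coefficient matrix of this linear system: each $h\in H$ indexes one column and each $p\in P$ indexes a block of $d$ columns; the row of $(p,h)\in I$ has entry $1$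 in the column of $h$, has the $d$ entries of $S_h$ in the $d$ columns of $p$ (in order), and is zero elsewhere. For $p\in P$, the pinned matrix $M_S^p(P,H,I)$ is obtained from $M_S(P,H,I)$ by adding, for each of the $d$ columns indexed by $p$, one new row that is zero except for a $1$ in that column. It has size $(|I|+d)\times(|H|+d|P|)$, hence is square when $|I| = |H|+d|P|-d$. The pure condition is the polynomial constraint $\det(M_X^p(P,H,I))=0$ on the entries of a $d\times |H|$ matrix $X$. *)

theory Defs
  imports "Jordan_Normal_Form.Determinant"
begin

definition incidence_geometry :: "'p set \<Rightarrow> 'h set \<Rightarrow> ('p \<times> 'h) set \<Rightarrow> bool" where
  "incidence_geometry P H I \<longleftrightarrow> finite P \<and> finite H \<and> I \<subseteq> P \<times> H"

(* The projections P(J) and H(J) are fst ` J and snd ` J.  Cardinalities are cast to int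
   so that the subtraction of d is not truncated. *)
definition plane_indep :: "nat \<Rightarrow> ('p \<times> 'h) set \<Rightarrow> bool" where
  "plane_indep d I' \<longleftrightarrow>
     (\<forall>J. J \<subseteq> I' \<and> J \<noteq> {} \<longrightarrow>
        int (card J) \<le> int (card (snd ` J)) + int d * int (card (fst ` J)) - int d)"

definition plane_basis :: "nat \<Rightarrow> 'p set \<Rightarrow> 'h set \<Rightarrow> ('p \<times> 'h) set \<Rightarrow> bool" where
  "plane_basis d P H I \<longleftrightarrow>
     plane_indep d I \<and> int (card I) = int (card H) + int d * int (card P) - int d"

(* A d x H matrix S is given by its columns: S h is a vector of dimension d for each h in H. *)
definition realization ::
  "nat \<Rightarrow> 'p set \<Rightarrow> ('p \<times> 'h) set \<Rightarrow> ('h \<Rightarrow> real vec) \<Rightarrow> ('p \<Rightarrow> real vec) \<Rightarrow> ('h \<Rightarrow> real) \<Rightarrow> bool" where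
  "realization d P I S x y \<longleftrightarrow>
     x \<in> P \<rightarrow> carrier_vec d \<and> (\<forall>(p, h) \<in> I. S h \<bullet> x p + y h = 0)"

definition trivial_realization :: "nat \<Rightarrow> 'p set \<Rightarrow> ('p \<Rightarrow> real vec) \<Rightarrow> bool" where
  "trivial_realization d P x \<longleftrightarrow> (\<exists>c \<in> carrier_vec d. \<forall>p \<in> P. x p = c)"

(* Library matrices have numbered rows and columns, so the matrices below take enumerations
   es, hs, ps of I, H, P as arguments.  Another choice permutes rows and columns and hence
   changes the determinant at most by a sign.
   Inl h is the column of h; Inr (p, k) is the k-th column of the block of p (0 <= k < d). *)
definition column_labels :: "nat \<Rightarrow> 'h list \<Rightarrow> 'p list \<Rightarrow> ('h + 'p \<times> nat) list" where
  "column_labels d hs ps = map Inl hs @ map Inr (List.product ps [0..<d])"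

fun coeff_entry :: "('h \<Rightarrow> real vec) \<Rightarrow> 'p \<times> 'h \<Rightarrow> 'h + 'p \<times> nat \<Rightarrow> real" where
  "coeff_entry S (p, h) (Inl h') = (if h' = h then 1 else 0)"
| "coeff_entry S (p, h) (Inr (p', k)) = (if p' = p then S h $ k else 0)"

definition coeff_matrix ::
  "nat \<Rightarrow> ('p \<times> 'h) list \<Rightarrow> 'h list \<Rightarrow> 'p list \<Rightarrow> ('h \<Rightarrow> real vec) \<Rightarrow> real mat" where
  "coeff_matrix d es hs ps S =
     (let cs = column_labels d hs ps in
      mat (length es) (length cs) (\<lambda>(i, j). coeff_entry S (es ! i) (cs ! j)))"

definition pinned_matrix ::
  "nat \<Rightarrow> ('p \<times> 'h) list \<Rightarrow> 'h list \<Rightarrow> 'p list \<Rightarrow> 'p \<Rightarrow> ('h \<Rightarrow> real vec) \<Rightarrow> real mat" where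
  "pinned_matrix d es hs ps p S =
     (let cs = column_labels d hs ps in
      coeff_matrix d es hs ps S @\<^sub>r
      mat d (length cs) (\<lambda>(k, j). if cs ! j = Inr (p, k) then 1 else 0))"

end

theory Submission
  imports Defs
begin

text \<open>Realizations may be translated: moving all points by a vector \<open>t\<close> and correcting the
  offset of each hyperplane \<open>h\<close> by the scalar product of \<open>S h\<close> and \<open>t\<close> preserves all incidences.  Hence
  a nontrivial realization exists if and only if there is one that keeps \<open>p\<close> at the origin and
  moves some other point away from it.  The rows added in the pinned matrix say precisely that
  \<open>p\<close> sits at the origin, so its kernel consists of the realizations pinned at \<open>p\<close>
  (lemma \<open>det_pinned_zero_iff\<close>), and as the basis condition makes the matrix square, a zero
  determinant means that there is a nonzero pinned realization.

  A nonzero pinned realization could fail to be nontrivial only if all its points are at the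
  origin and some hyperplane has a nonzero offset.  An incidence with a point at the origin
  forces offset zero, so such a hyperplane would lie in no incidence.  The count in the
  definition of a basis leaves no room for this: independence applied to all of \<open>I\<close> shows that
  every hyperplane occurs in \<open>I\<close> (lemma \<open>plane_basis_hyperplanes\<close>).\<close>

section \<open>Bases and translations\<close>

text \<open>Independence bounds \<open>card I\<close> by a count of only those points and hyperplanes that occur in
  \<open>I\<close>.  A missing hyperplane would push this bound strictly below the count over all of \<open>P\<close> and
  \<open>H\<close>, which equals \<open>card I\<close>.  For empty \<open>I\<close> independence says nothing, but then
  the count itself reads \<open>card H = d * (1 - card P)\<close>, so that \<open>H\<close> is empty as \<open>P\<close> is not.\<close>

lemma plane_basis_hyperplanes:
  assumes "d \<ge> 1" "incidence_geometry P H I" "plane_basis d P H I" "P \<noteq> {}"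
  shows "snd ` I = H"
proof -
  have fin: "finite P" "finite H" and sub: "fst ` I \<subseteq> P" "snd ` I \<subseteq> H"
    using assms(2) by (auto simp: incidence_geometry_def)
  have indep: "plane_indep d I"
    and card: "int (card I) = int (card H) + int d * int (card P) - int d"
    using assms(3) by (auto simp: plane_basis_def)
  have P: "card (fst ` I) \<le> card P"
    using fin sub by (simp add: card_mono)
  have "card H \<le> card (snd ` I)"
  proof (cases "I = {}")
    case True
    have "card P \<ge> 1"
      using fin assms(4) by (simp add: Suc_le_eq card_gt_0_iff)
    then have "int d * 1 \<le> int d * int (card P)"
      by (intro mult_left_mono) auto
    with card True show ?thesis by simp
  next
    case False
    then have "int (card I) \<le> int (card (snd ` I)) + int d * int (card (fst ` I)) - int d"
      using indep by (auto simp: plane_indep_def)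
    moreover have "int d * int (card (fst ` I)) \<le> int d * int (card P)"
      using P by (intro mult_left_mono) auto
    ultimately show ?thesis using card by simp
  qed
  with fin sub show ?thesis
    by (simp add: card_seteq)
qed

lemma realization_translate:
  assumes "incidence_geometry P H I" "S \<in> H \<rightarrow> carrier_vec d"
    and "realization d P I S x y" "t \<in> carrier_vec d"
  shows "realization d P I S (\<lambda>q. x q - t) (\<lambda>h. y h + S h \<bullet> t)"
  unfolding realization_def
proof (intro conjI ballI, goal_cases)
  case 1
  then show ?case using assms(3,4) by (auto simp: realization_def intro!: minus_carrier_vec)
next
  case (2 e)
  obtain q h where e: "e = (q, h)" by (cases e)
  have "x q \<in> carrier_vec d" "S h \<in> carrier_vec d" "S h \<bullet> x q + y h = 0"
    using assms 2 e by (auto simp: incidence_geometry_def realization_def)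
  with assms(4) show ?case
    by (simp add: e scalar_prod_minus_distrib)
qed

section \<open>The kernel of the pinned matrix\<close>

text \<open>This fact and the next allow a vector indexed by positions to be replaced by a
  function on labels, so that matrix-vector products become sums over the set of labels.\<close>

lemma scalar_prod_enumeration:
  fixes f g :: "'c \<Rightarrow> 'a :: semiring_0"
  assumes "distinct cs"
  shows "vec (length cs) (\<lambda>j. f (cs ! j)) \<bullet> vec (length cs) (\<lambda>j. g (cs ! j))
    = (\<Sum>c\<in>set cs. f c * g c)"
proof -
  have "vec (length cs) (\<lambda>j. f (cs ! j)) \<bullet> vec (length cs) (\<lambda>j. g (cs ! j))
    = (\<Sum>j\<in>{..<length cs}. f (cs ! j) * g (cs ! j))"
    by (simp add: scalar_prod_def atLeast0LessThan)
  also have "\<dots> = (\<Sum>c\<in>set cs. f c * g c)"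
    using bij_betw_nth[OF assms refl refl] by (rule sum.reindex_bij_betw)
  finally show ?thesis .
qed

lemma vec_enumeration_surj:
  assumes "distinct cs" "v \<in> carrier_vec (length cs)"
  obtains z where "v = vec (length cs) (\<lambda>j. z (cs ! j))"
proof
  have "inj_on ((!) cs) {..<length cs}"
    using assms(1) by (simp add: inj_on_nth)
  then show "v = vec (length cs)
      (\<lambda>j. (\<lambda>c. v $ inv_into {..<length cs} ((!) cs) c) (cs ! j))"
    using assms(2) by (intro eq_vecI) (auto simp: inv_into_f_f)
qed

lemma set_column_labels:
  "set (column_labels d hs ps) = Inl ` set hs \<union> Inr ` (set ps \<times> {..<d})"
  by (auto simp: column_labels_def)

lemma distinct_column_labels:
  assumes "distinct hs" "distinct ps"
  shows "distinct (column_labels d hs ps)"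
  using assms by (auto simp: column_labels_def distinct_map distinct_product)

lemma length_column_labels:
  "length (column_labels d hs ps) = length hs + length ps * d"
  by (simp add: column_labels_def)

lemma coeff_row_sum:
  assumes "q \<in> set ps" "h \<in> set hs"
  shows "(\<Sum>c\<in>set (column_labels d hs ps). coeff_entry S (q, h) c * z c)
    = S h \<bullet> vec d (\<lambda>k. z (Inr (q, k))) + z (Inl h)"
proof -
  have "(\<Sum>c\<in>set (column_labels d hs ps). coeff_entry S (q, h) c * z c)
    = (\<Sum>c\<in>insert (Inl h) (Inr ` (\<lambda>k. (q, k)) ` {..<d}). coeff_entry S (q, h) c * z c)"
    using assms by (intro sum.mono_neutral_right) (auto simp: set_column_labels)
  also have "\<dots> = z (Inl h) + (\<Sum>k<d. S h $ k * z (Inr (q, k)))"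
    by (subst sum.insert) (auto simp: sum.reindex inj_on_def)
  finally show ?thesis
    by (simp add: scalar_prod_def atLeast0LessThan add.commute)
qed

lemma pin_row_sum:
  assumes "p \<in> set ps" "k < d"
  shows "(\<Sum>c\<in>set (column_labels d hs ps). (if c = Inr (p, k) then 1 else 0) * z c)
    = (z (Inr (p, k)) :: real)"
proof -
  have "(\<Sum>c\<in>set (column_labels d hs ps). (if c = Inr (p, k) then 1 else 0) * z c)
    = (\<Sum>c\<in>set (column_labels d hs ps). if c = Inr (p, k) then z c else 0)"
    by (intro sum.cong) auto
  also have "\<dots> = z (Inr (p, k))"
    using assms by (simp add: set_column_labels)
  finally show ?thesis .
qed

lemma pinned_kernel_iff:
  fixes hs :: "'h list" and ps :: "'p list" and d
  defines "cs \<equiv> column_labels d hs ps"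
  assumes dist: "distinct hs" "distinct ps"
    and es: "set es \<subseteq> set ps \<times> set hs" and p: "p \<in> set ps"
  shows "pinned_matrix d es hs ps p S *\<^sub>v vec (length cs) (\<lambda>j. z (cs ! j))
      = 0\<^sub>v (length es + d) \<longleftrightarrow>
    (\<forall>(q, h)\<in>set es. S h \<bullet> vec d (\<lambda>k. z (Inr (q, k))) + z (Inl h) = 0) \<and>
    (\<forall>k<d. z (Inr (p, k)) = 0)"
proof -
  let ?v = "vec (length cs) (\<lambda>j. z (cs ! j))"
  let ?C = "coeff_matrix d es hs ps S"
  let ?D = "mat d (length cs) (\<lambda>(k, j). if cs ! j = Inr (p, k) then 1 else 0) :: real mat"
  have cs: "distinct cs"
    unfolding cs_def using dist by (rule distinct_column_labels)
  have C: "?C \<in> carrier_mat (length es) (length cs)"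
    by (simp add: coeff_matrix_def cs_def Let_def)
  have "(?C *\<^sub>v ?v) $ i = (\<Sum>c\<in>set cs. coeff_entry S (es ! i) c * z c)" if "i < length es" for i
    using that scalar_prod_enumeration[OF cs, of "coeff_entry S (es ! i)" z]
    by (simp add: coeff_matrix_def cs_def[symmetric] Let_def)
  then have "?C *\<^sub>v ?v = 0\<^sub>v (length es) \<longleftrightarrow>
      (\<forall>i<length es. (\<Sum>c\<in>set cs. coeff_entry S (es ! i) c * z c) = 0)"
    using C by (auto simp: vec_eq_iff)
  also have "\<dots> \<longleftrightarrow> (\<forall>e\<in>set es. (\<Sum>c\<in>set cs. coeff_entry S e c * z c) = 0)"
    by (simp add: all_set_conv_all_nth)
  also have "\<dots> \<longleftrightarrow> (\<forall>(q, h)\<in>set es. S h \<bullet> vec d (\<lambda>k. z (Inr (q, k))) + z (Inl h) = 0)"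
  proof (intro ball_cong refl)
    fix e assume "e \<in> set es"
    with es show "(\<Sum>c\<in>set cs. coeff_entry S e c * z c) = 0 \<longleftrightarrow>
        (case e of (q, h) \<Rightarrow> S h \<bullet> vec d (\<lambda>k. z (Inr (q, k))) + z (Inl h) = 0)"
      by (cases e) (auto simp: cs_def coeff_row_sum)
  qed
  finally have 1: "?C *\<^sub>v ?v = 0\<^sub>v (length es) \<longleftrightarrow>
    (\<forall>(q, h)\<in>set es. S h \<bullet> vec d (\<lambda>k. z (Inr (q, k))) + z (Inl h) = 0)" .
  have "(?D *\<^sub>v ?v) $ k = z (Inr (p, k))" if "k < d" for k
    using that p scalar_prod_enumeration[OF cs, of "\<lambda>c. if c = Inr (p, k) then 1 else 0" z]
    by (simp add: cs_def pin_row_sum)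
  then have 2: "?D *\<^sub>v ?v = 0\<^sub>v d \<longleftrightarrow> (\<forall>k<d. z (Inr (p, k)) = 0)"
    by (auto simp: vec_eq_iff)
  have "pinned_matrix d es hs ps p S *\<^sub>v ?v = (?C *\<^sub>v ?v) @\<^sub>v (?D *\<^sub>v ?v)"
    unfolding pinned_matrix_def Let_def cs_def[symmetric]
    using C by (intro mat_mult_append) auto
  moreover have "(0\<^sub>v (length es + d) :: real vec) = 0\<^sub>v (length es) @\<^sub>v 0\<^sub>v d"
    by auto
  moreover have "(?C *\<^sub>v ?v) @\<^sub>v (?D *\<^sub>v ?v) = 0\<^sub>v (length es) @\<^sub>v 0\<^sub>v d \<longleftrightarrow>
      ?C *\<^sub>v ?v = 0\<^sub>v (length es) \<and> ?D *\<^sub>v ?v = 0\<^sub>v d"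
    using C by (intro append_vec_eq[of _ "length es"]) auto
  ultimately show ?thesis
    using 1 2 by simp
qed

text \<open>A kernel vector \<open>z\<close> holds the offset of \<open>h\<close> in entry \<open>Inl h\<close> and the coordinates of \<open>q\<close> in the
  entries \<open>Inr (q, k)\<close>.  The basis condition enters only through the equation \<open>square\<close>.\<close>

lemma det_pinned_zero_iff:
  fixes hs :: "'h list" and ps :: "'p list"
  assumes dist: "distinct hs" "distinct ps"
    and es: "set es \<subseteq> set ps \<times> set hs" and p: "p \<in> set ps"
    and square: "length es + d = length hs + length ps * d"
  shows "det (pinned_matrix d es hs ps p S) = 0 \<longleftrightarrow>
    (\<exists>x y. realization d (set ps) (set es) S x y \<and> x p = 0\<^sub>v d \<and>
      ((\<exists>q\<in>set ps. x q \<noteq> 0\<^sub>v d) \<or> (\<exists>h\<in>set hs. y h \<noteq> 0)))"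
    (is "_ \<longleftrightarrow> ?R")
proof -
  define cs where "cs = column_labels d hs ps"
  let ?A = "pinned_matrix d es hs ps p S"
  let ?v = "\<lambda>z. vec (length cs) (\<lambda>j. z (cs ! j)) :: real vec"
  have len: "length cs = length es + d"
    by (simp add: cs_def length_column_labels square)
  have "coeff_matrix d es hs ps S \<in> carrier_mat (length es) (length cs)"
    by (simp add: coeff_matrix_def cs_def Let_def)
  then have "?A \<in> carrier_mat (length es + d) (length cs)"
    unfolding pinned_matrix_def Let_def cs_def[symmetric]
    by (intro carrier_append_rows) auto
  then have A: "?A \<in> carrier_mat (length cs) (length cs)"
    by (simp add: len)
  have cs: "distinct cs"
    unfolding cs_def using dist by (rule distinct_column_labels)
  have kernel: "?A *\<^sub>v ?v z = 0\<^sub>v (length cs) \<longleftrightarrow>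
    (\<forall>(q, h)\<in>set es. S h \<bullet> vec d (\<lambda>k. z (Inr (q, k))) + z (Inl h) = 0) \<and>
    (\<forall>k<d. z (Inr (p, k)) = 0)" for z
    using pinned_kernel_iff[OF dist es p, of d S z] by (simp add: cs_def[symmetric] len[symmetric])
  have zero: "?v z = 0\<^sub>v (length cs) \<longleftrightarrow>
    (\<forall>q\<in>set ps. \<forall>k<d. z (Inr (q, k)) = 0) \<and> (\<forall>h\<in>set hs. z (Inl h) = 0)" for z
  proof -
    have "?v z = 0\<^sub>v (length cs) \<longleftrightarrow> (\<forall>c\<in>set cs. z c = 0)"
      by (auto simp: vec_eq_iff all_set_conv_all_nth)
    also have "\<dots> \<longleftrightarrow>
        (\<forall>q\<in>set ps. \<forall>k<d. z (Inr (q, k)) = 0) \<and> (\<forall>h\<in>set hs. z (Inl h) = 0)"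
      unfolding cs_def set_column_labels by auto
    finally show ?thesis .
  qed
  have "det ?A = 0 \<longleftrightarrow> (\<exists>v. v \<in> carrier_vec (length cs) \<and> v \<noteq> 0\<^sub>v (length cs) \<and>
      ?A *\<^sub>v v = 0\<^sub>v (length cs))"
    using det_0_iff_vec_prod_zero[OF A] .
  also have "\<dots> \<longleftrightarrow> (\<exists>z. ?v z \<noteq> 0\<^sub>v (length cs) \<and> ?A *\<^sub>v ?v z = 0\<^sub>v (length cs))"
    using vec_enumeration_surj[OF cs] by (metis vec_carrier)
  also have "\<dots> \<longleftrightarrow> ?R"
  proof
    assume "\<exists>z. ?v z \<noteq> 0\<^sub>v (length cs) \<and> ?A *\<^sub>v ?v z = 0\<^sub>v (length cs)"
    then obtain z where z: "?v z \<noteq> 0\<^sub>v (length cs)" "?A *\<^sub>v ?v z = 0\<^sub>v (length cs)"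
      by blast
    let ?x = "\<lambda>q. vec d (\<lambda>k. z (Inr (q, k)))" and ?y = "\<lambda>h. z (Inl h)"
    have "realization d (set ps) (set es) S ?x ?y" "?x p = 0\<^sub>v d"
      using z(2)[unfolded kernel] by (auto simp: realization_def vec_eq_iff)
    moreover have "(\<exists>q\<in>set ps. ?x q \<noteq> 0\<^sub>v d) \<or> (\<exists>h\<in>set hs. ?y h \<noteq> 0)"
      using z(1)[unfolded zero] by (auto simp: vec_eq_iff)
    ultimately show ?R by blast
  next
    assume ?R
    then obtain x y where xy: "realization d (set ps) (set es) S x y" "x p = 0\<^sub>v d"
      "(\<exists>q\<in>set ps. x q \<noteq> 0\<^sub>v d) \<or> (\<exists>h\<in>set hs. y h \<noteq> 0)"
      by blast
    define z where "z = case_sum y (\<lambda>(q, k). x q $ k)"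
    have x: "vec d (\<lambda>k. z (Inr (q, k))) = x q" if "q \<in> set ps" for q
    proof -
      have "x q \<in> carrier_vec d"
        using that xy(1) by (auto simp: realization_def)
      then show ?thesis
        by (intro eq_vecI) (auto simp: z_def)
    qed
    have "?v z \<noteq> 0\<^sub>v (length cs)"
    proof
      assume "?v z = 0\<^sub>v (length cs)"
      then have "\<forall>q\<in>set ps. vec d (\<lambda>k. z (Inr (q, k))) = 0\<^sub>v d" "\<forall>h\<in>set hs. y h = 0"
        unfolding zero by (auto simp: z_def vec_eq_iff)
      with x xy(3) show False by auto
    qed
    moreover have "?A *\<^sub>v ?v z = 0\<^sub>v (length cs)"
      unfolding kernel
    proof (intro conjI ballI)
      fix e assume e: "e \<in> set es"
      obtain q h where [simp]: "e = (q, h)" by (cases e)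
      have "q \<in> set ps" using e es by auto
      with e xy(1) show "case e of (q, h) \<Rightarrow>
          S h \<bullet> vec d (\<lambda>k. z (Inr (q, k))) + z (Inl h) = 0"
        by (auto simp: x realization_def) (auto simp: z_def)
    qed (use xy(2) in \<open>auto simp: z_def\<close>)
    ultimately show "\<exists>z. ?v z \<noteq> 0\<^sub>v (length cs) \<and> ?A *\<^sub>v ?v z = 0\<^sub>v (length cs)"
      by blast
  qed
  finally show ?thesis .
qed

section \<open>The pure condition\<close>

theorem mainTheorem3:
  fixes d :: nat
    and P :: "'p set" and H :: "'h set" and I :: "('p \<times> 'h) set"
    and p :: 'p and S :: "'h \<Rightarrow> real vec"
    and es :: "('p \<times> 'h) list" and hs :: "'h list" and ps :: "'p list"
  assumes "d \<ge> 1"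
    and "incidence_geometry P H I"
    and "plane_basis d P H I"
    and "p \<in> P"
    and "S \<in> H \<rightarrow> carrier_vec d"
    and "distinct es" "set es = I"
    and "distinct hs" "set hs = H"
    and "distinct ps" "set ps = P"
  shows "(\<exists>x y. realization d P I S x y \<and> \<not> trivial_realization d P x)
           \<longleftrightarrow> det (pinned_matrix d es hs ps p S) = 0"
proof -
  have sub: "I \<subseteq> P \<times> H"
    using assms(2) by (simp add: incidence_geometry_def)
  have "length es = card I" "length hs = card H" "length ps = card P"
    using assms(6-11) distinct_card by metis+
  moreover have "int (card I) + int d = int (card H) + int (card P) * int d"
    using assms(3) by (simp add: plane_basis_def)
  ultimately have "int (length es + d) = int (length hs + length ps * d)"
    by simp
  then have square: "length es + d = length hs + length ps * d"
    by (simp only: of_nat_eq_iff)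
  have det: "det (pinned_matrix d es hs ps p S) = 0 \<longleftrightarrow>
    (\<exists>x y. realization d P I S x y \<and> x p = 0\<^sub>v d \<and>
      ((\<exists>q\<in>P. x q \<noteq> 0\<^sub>v d) \<or> (\<exists>h\<in>H. y h \<noteq> 0)))"
    using det_pinned_zero_iff[of hs ps es p d S] square sub assms(4,7-11) by auto
  show ?thesis
    unfolding det
  proof
    assume "\<exists>x y. realization d P I S x y \<and> \<not> trivial_realization d P x"
    then obtain x y where xy: "realization d P I S x y" "\<not> trivial_realization d P x"
      by blast
    have x: "x q \<in> carrier_vec d" if "q \<in> P" for q
      using xy(1) that by (auto simp: realization_def)
    have "realization d P I S (\<lambda>q. x q - x p) (\<lambda>h. y h + S h \<bullet> x p)"
      using assms(2,5) xy(1) x[OF assms(4)] by (rule realization_translate)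
    moreover have "x p - x p = 0\<^sub>v d"
      using x[OF assms(4)] by simp
    moreover have "\<exists>q\<in>P. x q - x p \<noteq> 0\<^sub>v d"
    proof (rule ccontr)
      assume "\<not> ?thesis"
      then have diff: "x q - x p = 0\<^sub>v d" if "q \<in> P" for q
        using that by blast
      have "x q = x p" if "q \<in> P" for q
      proof -
        have "x q = (x q - x p) + x p"
          using x[OF that] x[OF assms(4)] by auto
        then show ?thesis
          using diff[OF that] x[OF assms(4)] by simp
      qed
      with xy(2) x[OF assms(4)] show False
        by (auto simp: trivial_realization_def)
    qed
    ultimately show "\<exists>x y. realization d P I S x y \<and> x p = 0\<^sub>v d \<and>
        ((\<exists>q\<in>P. x q \<noteq> 0\<^sub>v d) \<or> (\<exists>h\<in>H. y h \<noteq> 0))"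
      by (intro exI[of _ "\<lambda>q. x q - x p"] exI[of _ "\<lambda>h. y h + S h \<bullet> x p"]) auto
  next
    assume "\<exists>x y. realization d P I S x y \<and> x p = 0\<^sub>v d \<and>
        ((\<exists>q\<in>P. x q \<noteq> 0\<^sub>v d) \<or> (\<exists>h\<in>H. y h \<noteq> 0))"
    then obtain x y where xy: "realization d P I S x y" "x p = 0\<^sub>v d"
      "(\<exists>q\<in>P. x q \<noteq> 0\<^sub>v d) \<or> (\<exists>h\<in>H. y h \<noteq> 0)"
      by blast
    have "\<not> trivial_realization d P x"
    proof
      assume "trivial_realization d P x"
      then have x: "x q = 0\<^sub>v d" if "q \<in> P" for q
        using that assms(4) xy(2) by (auto simp: trivial_realization_def)
      have "y h = 0" if "h \<in> H" for h
      proof -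
        have "h \<in> snd ` I"
          using plane_basis_hyperplanes[OF assms(1-3)] assms(4) that by auto
        then obtain q where q: "(q, h) \<in> I" by auto
        then have "S h \<bullet> x q + y h = 0" "q \<in> P" "S h \<in> carrier_vec d"
          using xy(1) sub that assms(5) by (auto simp: realization_def)
        then show ?thesis by (simp add: x)
      qed
      with x xy(3) show False by blast
    qed
    with xy(1) show "\<exists>x y. realization d P I S x y \<and> \<not> trivial_realization d P x"
      by blast
  qed
qed

end
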